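(* For any positive integer $m\ge 1$, there exists a finite tree $T$ such that, writing $\gamma=\gamma(T)$, \[ d_{\gamma+2j+1}(T)^{2}<d_{\gamma+2j}(T)\,d_{\gamma+2j+2}(T)\qquad\text{for all integers } 0\le j\le m-1 . \]
   Context: For a finite undirected graph $G$ with vertex set $V$, a dominating set is a set $S\subseteq V$ such that every vertex of $G$ is in $S$ or is adjacent to a vertex of $S$. For an integer $j\ge 0$, $d_j(G)$ denotes the number of dominating sets of $G$ of cardinality $j$. $\gamma(G)$ denotes the cardinality of a smallest dominating set of $G$. *)

theory Defs
  imports "Graph_Theory.Graph_Theory"
begin

text \<open>
  A finite simple undirected graph is a \<^locale>\<open>pair_graph\<close>: a finite vertex set with a
  symmetric irreflexive set of arcs, each edge being represented by its two opposite arcs.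

  The library's \<^const>\<open>forest\<close> and \<^const>\<open>tree\<close> are not the undirected notions: on a symmetric
  digraph the closed walk \<open>u, v, u\<close> along a single edge is a \<^const>\<open>pre_digraph.cycle\<close>, so a
  graph with an edge is never a \<^const>\<open>tree\<close>. A cycle of the undirected graph is a cycle
  of length at least 3. The null graph is not \<^const>\<open>Digraph_Component.connected\<close>.
\<close>

definition undirected_cycle :: "'a pair_pre_digraph \<Rightarrow> ('a \<times> 'a) list \<Rightarrow> bool" where
  "undirected_cycle G p \<longleftrightarrow> pre_digraph.cycle (with_proj G) p \<and> 3 \<le> length p"

definition undirected_tree :: "'a pair_pre_digraph \<Rightarrow> bool" where
  "undirected_tree G \<longleftrightarrow>
     pair_graph G \<and> Digraph_Component.connected (with_proj G) \<and> \<not> (\<exists>p. undirected_cycle G p)"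

definition dominating_set :: "'a pair_pre_digraph \<Rightarrow> 'a set \<Rightarrow> bool" where
  "dominating_set G S \<longleftrightarrow>
     S \<subseteq> pverts G \<and> (\<forall>v\<in>pverts G. v \<in> S \<or> (\<exists>u\<in>S. (v, u) \<in> parcs G))"

definition num_dominating_sets :: "'a pair_pre_digraph \<Rightarrow> nat \<Rightarrow> nat" where
  "num_dominating_sets G j = card {S. dominating_set G S \<and> card S = j}"

definition domination_number :: "'a pair_pre_digraph \<Rightarrow> nat" where
  "domination_number G = Min (card ` {S. dominating_set G S})"

end

theory Submission
  imports Defs
begin

text \<open>
  The tree is a path of \<open>m\<close> centres. Each centre carries three hubs, and each hub carries \<open>t\<close> legs,
  a leg being a path of three vertices (near, mid, tip) attached to the hub at its near end; here
  \<open>m\<close> is fixed and \<open>t\<close> is large. A centre with its three hubs and their legs is called a gadget.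

  Every leg needs a vertex of the dominating set, to dominate its tip. If the hub is not chosen, the
  only way to dominate the leg with a single one of its vertices is to take the mid; if the hub is
  chosen, the near vertex is already dominated, and mid and tip both work. So a chosen hub is worth
  a factor \<open>2^t\<close>, which dwarfs everything polynomial in \<open>t\<close>, and the growth of the numbers of
  dominating sets is governed by how many hubs a set of given size can afford.

  The centre makes hubs cheaper in threes. A gadget without chosen hubs needs its centre (or extra
  near vertices) to dominate the hubs, so its minimum size is \<open>3t + 1\<close>. Choosing one or two hubs
  costs one extra vertex each, because the centre still has to dominate the others. Choosing all
  three costs only two extra vertices, since the centre can then be dropped. Hence a
  dominating set of \<open>e\<close> vertices more than the minimum \<open>\<gamma> = m(3t + 1)\<close> contains at most
  \<open>3e/2\<close> hubs, and this is attained for even \<open>e \<le> 2m\<close>. For \<open>e = 2j\<close> this yields at least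
  \<open>2^(3jt)\<close> dominating sets, whereas for \<open>e = 2j + 1\<close> the rounding leaves
  only \<open>3j + 1\<close> hubs and so at most \<open>P(t) 2^((3j + 1)t)\<close> dominating sets, with a polynomial \<open>P\<close>.
  As \<open>2 (3j + 1) + 1 = 3j + 3(j + 1)\<close>, log-concavity fails at \<open>\<gamma> + 2j + 1\<close> as soon as
  \<open>P(t)^2 < 2^t\<close>.

  The hub bound is \<open>dominating_set_size_ge\<close>, the two counts are \<open>num_dominating_sets_ge\<close> and
  \<open>num_dominating_sets_le\<close>. That the graph is a tree follows from its description
  by a parent function.
\<close>

section \<open>Trees given by a parent function\<close>

definition parent_graph :: "'a set \<Rightarrow> ('a \<Rightarrow> 'a) \<Rightarrow> 'a \<Rightarrow> 'a pair_pre_digraph" where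
  "parent_graph V par r = \<lparr>pverts = V, parcs = {(x, y).
     x \<in> V \<and> y \<in> V \<and> (x \<noteq> r \<and> y = par x \<or> y \<noteq> r \<and> x = par y)}\<rparr>"

lemma pverts_parent_graph [simp]: "pverts (parent_graph V par r) = V"
  by (simp add: parent_graph_def)

lemma parcs_parent_graph:
  "(x, y) \<in> parcs (parent_graph V par r) \<longleftrightarrow>
     x \<in> V \<and> y \<in> V \<and> (x \<noteq> r \<and> y = par x \<or> y \<noteq> r \<and> x = par y)"
  by (simp add: parent_graph_def)

text \<open>
  Cycles are given as arc walks with a start vertex; reading the indices modulo the length
  makes all arcs alike.
\<close>

lemma undirected_cycle_consecutive_arcs:
  assumes "undirected_cycle G p"
  shows "set p \<subseteq> parcs G" and "distinct (map snd p)"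
    and "i < length p \<Longrightarrow> fst (p ! (Suc i mod length p)) = snd (p ! i)"
proof -
  interpret pair_pre_digraph G .
  obtain u where walk: "awalk u p u" and dist: "distinct (tl (pawalk_verts u p))"
    and ne: "p \<noteq> []" and len: "3 \<le> length p"
    using assms by (auto simp: undirected_cycle_def cycle_def)
  then have cas: "pcas u p u" and arcs: "set p \<subseteq> parcs G"
    by (auto simp: awalk_def)
  have v1: "pawalk_verts u p = map fst p @ [snd (last p)]"
    using awalk_verts_conv[of u p] ne by simp
  have v2: "pawalk_verts u p = fst (hd p) # map snd p"
    using awalk_verts_conv'[of u p u] ne cas by simp
  have closed: "fst (hd p) = snd (last p)"
  proof -
    have "pcas x q y \<Longrightarrow> q \<noteq> [] \<Longrightarrow> fst (hd q) = x \<and> snd (last q) = y" for x q y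
      by (induction q arbitrary: x) auto
    then show ?thesis using cas ne by metis
  qed
  show "set p \<subseteq> parcs G" by (fact arcs)
  show "distinct (map snd p)" using dist v2 by simp
  show "fst (p ! (Suc i mod length p)) = snd (p ! i)" if i: "i < length p"
  proof (cases "Suc i = length p")
    case True
    then have "p ! i = last p" using ne by (metis last_conv_nth diff_Suc_1)
    then show ?thesis using True closed ne by (simp add: hd_conv_nth)
  next
    case False
    then have lt: "Suc i < length p" using i by simp
    have "(map fst p @ [snd (last p)]) ! Suc i = (fst (hd p) # map snd p) ! Suc i"
      using v1 v2 by simp
    then show ?thesis using lt by (simp add: nth_append)
  qed
qed

text \<open>
  Towards the root the rank decreases, so every vertex is joined to the root. A vertex of
  maximal rank on a cycle can only have its parent as its two neighbours on the cycle; on a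
  cycle of length at least 3 these neighbours would be different.
\<close>

lemma undirected_tree_parent_graph:
  fixes rank :: "'a \<Rightarrow> nat"
  assumes fin: "finite V" and r: "r \<in> V"
    and par: "\<And>x. x \<in> V \<Longrightarrow> x \<noteq> r \<Longrightarrow> par x \<in> V \<and> rank (par x) < rank x"
  shows "undirected_tree (parent_graph V par r)"
proof -
  let ?G = "parent_graph V par r"
  have arcsub: "parcs ?G \<subseteq> V \<times> V" by (auto simp: parcs_parent_graph)
  have symG: "symmetric ?G"
    by (auto simp: symmetric_def sym_def parcs_parent_graph)
  interpret pair_graph ?G
  proof
    show "finite (parcs ?G)" using finite_subset[OF arcsub] fin by simp
    show "fst e \<noteq> snd e" if "e \<in> parcs ?G" for e
      using that par by (cases e) (fastforce simp: parcs_parent_graph)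
    show "symmetric ?G" by (fact symG)
  qed (use arcsub fin in auto)
  have to_root: "x \<rightarrow>\<^sup>*\<^bsub>?G\<^esub> r" if "x \<in> V" for x
    using that
  proof (induction "rank x" arbitrary: x rule: less_induct)
    case less
    show ?case
    proof (cases "x = r")
      case True
      then show ?thesis using less by simp
    next
      case False
      then have "(x, par x) \<in> parcs ?G"
        using par less.prems by (auto simp: parcs_parent_graph)
      moreover have "par x \<rightarrow>\<^sup>*\<^bsub>?G\<^esub> r" using False less par by blast
      ultimately show ?thesis by (metis adj_reachable_trans)
    qed
  qed
  have sym_reach: "u \<rightarrow>\<^sup>*\<^bsub>?G\<^esub> v \<Longrightarrow> v \<rightarrow>\<^sup>*\<^bsub>?G\<^esub> u" for u v
    by (rule symmetric_reachable[OF symG])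
  have "u \<rightarrow>\<^sup>*\<^bsub>?G\<^esub> v" if "u \<in> V" "v \<in> V" for u v
    using to_root[OF that(1)] sym_reach[OF to_root[OF that(2)]] by (rule reachable_trans)
  then have conn: "Digraph_Component.connected (with_proj ?G)"
    unfolding connected_def using r
    by (auto simp: strongly_connected_def intro: reachable_mk_symmetricI)
  have "\<not> undirected_cycle ?G p" for p
  proof
    assume cyc: "undirected_cycle ?G p"
    note arcs = undirected_cycle_consecutive_arcs[OF cyc]
    let ?n = "length p"
    have n3: "3 \<le> ?n" using cyc by (simp add: undirected_cycle_def)
    have up: "fst (p ! i) = par (snd (p ! i)) \<or>
        rank (snd (p ! i)) < rank (fst (p ! i))" if "i < ?n" for i
    proof -
      have "(fst (p ! i), snd (p ! i)) \<in> parcs ?G" using arcs(1) that by auto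
      then show ?thesis unfolding parcs_parent_graph using par by metis
    qed
    have down: "snd (p ! i) = par (fst (p ! i)) \<or>
        rank (fst (p ! i)) < rank (snd (p ! i))" if "i < ?n" for i
    proof -
      have "(fst (p ! i), snd (p ! i)) \<in> parcs ?G" using arcs(1) that by auto
      then show ?thesis unfolding parcs_parent_graph using par by metis
    qed
    have "\<exists>i<?n. \<forall>j<?n. rank (snd (p ! j)) \<le> rank (snd (p ! i))"
    proof -
      let ?R = "(\<lambda>i. rank (snd (p ! i))) ` {..<?n}"
      have "Max ?R \<in> ?R" by (rule Max_in) (use n3 in \<open>auto simp: lessThan_empty_iff\<close>)
      then obtain i where i: "i < ?n" "Max ?R = rank (snd (p ! i))" by auto
      have "rank (snd (p ! j)) \<le> rank (snd (p ! i))" if "j < ?n" for j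
        unfolding i(2)[symmetric] by (rule Max_ge) (use that in auto)
      then show ?thesis using i(1) by blast
    qed
    then obtain i where i: "i < ?n"
      and top: "\<And>j. j < ?n \<Longrightarrow> rank (snd (p ! j)) \<le> rank (snd (p ! i))" by blast
    define k where "k = Suc i mod ?n"
    \<comment> \<open>the arcs number \<open>l\<close>, \<open>i\<close>, \<open>k\<close> are consecutive on the cycle, up to wrap-around\<close>
    define l where "l = (if i = 0 then ?n - 1 else i - 1)"
    have kl: "k < ?n" "l < ?n"
      unfolding k_def by (rule mod_less_divisor, use i in linarith) (use i in \<open>auto simp: l_def\<close>)
    have "Suc l mod ?n = i" using i n3 by (auto simp: l_def)
    then have l_i: "fst (p ! i) = snd (p ! l)" using arcs(3)[OF kl(2)] by simp
    have i_k: "fst (p ! k) = snd (p ! i)" using arcs(3)[OF i] by (simp add: k_def)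
    have "snd (p ! l) = par (snd (p ! i))"
      using up[OF i] top[OF kl(2)] l_i by auto
    moreover have "snd (p ! k) = par (snd (p ! i))"
      using down[OF kl(1)] top[OF kl(1)] i_k by auto
    ultimately have "map snd p ! l = map snd p ! k" using kl by simp
    then have "l = k" using nth_eq_iff_index_eq[OF arcs(2)] kl by auto
    moreover have "l \<noteq> k"
      using i n3 by (cases "Suc i = ?n") (auto simp: k_def l_def)
    ultimately show False by simp
  qed
  then show ?thesis
    using conn pair_graph_axioms by (auto simp: undirected_tree_def)
qed

section \<open>Relabelling vertices\<close>

locale graph_relabelling =
  fixes G :: "'a pair_pre_digraph" and H :: "'b pair_pre_digraph" and f :: "'a \<Rightarrow> 'b"
  assumes verts: "pverts H = f ` pverts G"
    and inj: "inj_on f (pverts G)"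
    and arcs: "\<And>x y. x \<in> pverts G \<Longrightarrow> y \<in> pverts G \<Longrightarrow>
      (f x, f y) \<in> parcs H \<longleftrightarrow> (x, y) \<in> parcs G"
begin

lemma dominating_set_image:
  assumes "S \<subseteq> pverts G"
  shows "dominating_set H (f ` S) \<longleftrightarrow> dominating_set G S"
proof -
  have "f v \<in> f ` S \<longleftrightarrow> v \<in> S" if "v \<in> pverts G" for v
    using inj that assms by (auto dest: inj_onD)
  moreover have "(\<exists>u\<in>f ` S. (f v, u) \<in> parcs H) \<longleftrightarrow> (\<exists>u\<in>S. (v, u) \<in> parcs G)"
    if "v \<in> pverts G" for v
    using arcs[OF that] assms by blast
  ultimately show ?thesis
    using assms by (auto simp: dominating_set_def verts)
qed

lemma dominating_sets_eq: "{T. dominating_set H T} = image f ` {S. dominating_set G S}"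
proof (intro equalityI subsetI)
  fix T assume "T \<in> {T. dominating_set H T}"
  then have T: "dominating_set H T" by simp
  then obtain S where S: "S \<subseteq> pverts G" "T = f ` S"
    by (auto simp: dominating_set_def verts subset_image_iff)
  then show "T \<in> image f ` {S. dominating_set G S}"
    using T dominating_set_image by blast
next
  fix T assume "T \<in> image f ` {S. dominating_set G S}"
  then obtain S where "dominating_set G S" "T = f ` S" by blast
  then show "T \<in> {T. dominating_set H T}"
    using dominating_set_image[of S] by (simp add: dominating_set_def)
qed

lemma card_image_dominating_set: "dominating_set G S \<Longrightarrow> card (f ` S) = card S"
  by (rule card_image) (auto simp: dominating_set_def intro: inj_on_subset[OF inj])

lemma num_dominating_sets_eq: "num_dominating_sets H j = num_dominating_sets G j"
proof -
  have "{T. dominating_set H T \<and> card T = j} = {T. dominating_set H T} \<inter> {T. card T = j}"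
    by auto
  also have "\<dots> = image f ` {S. dominating_set G S \<and> card S = j}"
    unfolding dominating_sets_eq using card_image_dominating_set by auto
  finally show ?thesis
    unfolding num_dominating_sets_def
    by (simp, intro card_image inj_on_subset[OF inj_on_image_Pow[OF inj]])
       (auto simp: dominating_set_def)
qed

lemma domination_number_eq: "domination_number H = domination_number G"
  unfolding domination_number_def dominating_sets_eq image_image
  using card_image_dominating_set by (metis (mono_tags, lifting) image_cong mem_Collect_eq)

end

text \<open>
  A tree with structured vertices can be replaced by one on the natural numbers: parent
  function and rank are transported along any injective numbering of the vertices.
\<close>

lemma parent_graph_nat_copy:
  fixes rank :: "'a \<Rightarrow> nat"
  assumes fin: "finite V" and r: "r \<in> V"
    and par: "\<And>x. x \<in> V \<Longrightarrow> x \<noteq> r \<Longrightarrow> par x \<in> V \<and> rank (par x) < rank x"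
  shows "\<exists>T :: nat pair_pre_digraph. undirected_tree T \<and>
    domination_number T = domination_number (parent_graph V par r) \<and>
    (\<forall>j. num_dominating_sets T j = num_dominating_sets (parent_graph V par r) j)"
proof -
  obtain f :: "'a \<Rightarrow> nat" where f: "inj_on f V"
    using finite_imp_inj_to_nat_seg[OF fin] by blast
  let ?g = "inv_into V f"
  have g: "?g (f x) = x" if "x \<in> V" for x
    using f that by simp
  let ?T = "parent_graph (f ` V) (f \<circ> par \<circ> ?g) (f r)"
  have eq: "f x = f y \<longleftrightarrow> x = y" if "x \<in> V" "y \<in> V" for x y
    using f that by (auto dest: inj_onD)
  have tree: "undirected_tree ?T"
  proof (rule undirected_tree_parent_graph[where rank = "rank \<circ> ?g"])
    fix y assume "y \<in> f ` V" "y \<noteq> f r"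
    then obtain x where "y = f x" "x \<in> V" "x \<noteq> r" by blast
    then show "(f \<circ> par \<circ> ?g) y \<in> f ` V \<and> (rank \<circ> ?g) ((f \<circ> par \<circ> ?g) y) < (rank \<circ> ?g) y"
      using par[of x] g by simp
  qed (use fin r in auto)
  interpret graph_relabelling "parent_graph V par r" ?T f
  proof
    fix x y assume "x \<in> pverts (parent_graph V par r)" "y \<in> pverts (parent_graph V par r)"
    then have "x \<in> V" "y \<in> V" by simp_all
    then show "(f x, f y) \<in> parcs ?T \<longleftrightarrow> (x, y) \<in> parcs (parent_graph V par r)"
      using par[of x] par[of y] r by (auto simp: parcs_parent_graph g eq)
  qed (use f in simp_all)
  show ?thesis
    using tree num_dominating_sets_eq domination_number_eq by blast
qed

section \<open>Gadget trees\<close>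

datatype vertex =
    Centre nat
  | Hub nat nat
  | Near nat nat nat
  | Mid nat nat nat
  | Tip nat nat nat

fun parent_of :: "vertex \<Rightarrow> vertex" where
  "parent_of (Centre i) = Centre (i - 1)"
| "parent_of (Hub i k) = Centre i"
| "parent_of (Near i k l) = Hub i k"
| "parent_of (Mid i k l) = Near i k l"
| "parent_of (Tip i k l) = Mid i k l"

fun depth :: "vertex \<Rightarrow> nat" where
  "depth (Centre i) = i"
| "depth (Hub i k) = i + 1"
| "depth (Near i k l) = i + 2"
| "depth (Mid i k l) = i + 3"
| "depth (Tip i k l) = i + 4"

fun in_range :: "nat \<Rightarrow> nat \<Rightarrow> vertex \<Rightarrow> bool" where
  "in_range m t (Centre i) \<longleftrightarrow> i < m"
| "in_range m t (Hub i k) \<longleftrightarrow> i < m \<and> k < 3"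
| "in_range m t (Near i k l) \<longleftrightarrow> i < m \<and> k < 3 \<and> l < t"
| "in_range m t (Mid i k l) \<longleftrightarrow> i < m \<and> k < 3 \<and> l < t"
| "in_range m t (Tip i k l) \<longleftrightarrow> i < m \<and> k < 3 \<and> l < t"

definition vertices :: "nat \<Rightarrow> nat \<Rightarrow> vertex set" where
  "vertices m t = {x. in_range m t x}"

definition gadget_tree :: "nat \<Rightarrow> nat \<Rightarrow> vertex pair_pre_digraph" where
  "gadget_tree m t = parent_graph (vertices m t) parent_of (Centre 0)"

lemma pverts_gadget_tree [simp]: "pverts (gadget_tree m t) = vertices m t"
  by (simp add: gadget_tree_def)

definition leg_size :: "vertex set \<Rightarrow> nat \<Rightarrow> nat \<Rightarrow> nat \<Rightarrow> nat" where
  "leg_size S i k l =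
     of_bool (Near i k l \<in> S) + of_bool (Mid i k l \<in> S) + of_bool (Tip i k l \<in> S)"

definition hub_count :: "nat \<Rightarrow> vertex set \<Rightarrow> nat" where
  "hub_count m S = (\<Sum>i<m. \<Sum>k<3. of_bool (Hub i k \<in> S))"

lemma vertices_eq:
  "vertices m t = Centre ` {..<m}
     \<union> (\<lambda>(i, k). Hub i k) ` ({..<m} \<times> {..<3})
     \<union> (\<lambda>(i, k, l). Near i k l) ` ({..<m} \<times> {..<3} \<times> {..<t})
     \<union> (\<lambda>(i, k, l). Mid i k l) ` ({..<m} \<times> {..<3} \<times> {..<t})
     \<union> (\<lambda>(i, k, l). Tip i k l) ` ({..<m} \<times> {..<3} \<times> {..<t})"
    (is "?L = ?R")
proof (rule set_eqI)
  show "x \<in> ?L \<longleftrightarrow> x \<in> ?R" for x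
    by (cases x) (auto simp: vertices_def image_iff)
qed

lemma finite_vertices: "finite (vertices m t)"
  unfolding vertices_eq by simp

lemma card_eq_sum_of_gadgets:
  assumes "S \<subseteq> vertices m t"
  shows "card S = (\<Sum>i<m. of_bool (Centre i \<in> S) +
    (\<Sum>k<3. of_bool (Hub i k \<in> S) + (\<Sum>l<t. leg_size S i k l)))"
proof -
  let ?f = "\<lambda>x. of_bool (x \<in> S) :: nat"
  have "card S = (\<Sum>x\<in>vertices m t. ?f x)"
    using assms finite_vertices by (simp add: sum.If_cases of_bool_def Int_absorb1)
  also have "\<dots> = (\<Sum>i<m. ?f (Centre i)) + (\<Sum>(i, k)\<in>{..<m} \<times> {..<3}. ?f (Hub i k))
     + (\<Sum>(i, k, l)\<in>{..<m} \<times> {..<3} \<times> {..<t}. ?f (Near i k l))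
     + (\<Sum>(i, k, l)\<in>{..<m} \<times> {..<3} \<times> {..<t}. ?f (Mid i k l))
     + (\<Sum>(i, k, l)\<in>{..<m} \<times> {..<3} \<times> {..<t}. ?f (Tip i k l))"
    unfolding vertices_eq
    by (subst sum.union_disjoint; (simp; fail)?; (fastforce; fail)?)+
       (simp add: sum.reindex inj_on_def case_prod_unfold del: sum_of_bool_eq)
  also have "\<dots> = (\<Sum>i<m. of_bool (Centre i \<in> S) +
    (\<Sum>k<3. of_bool (Hub i k \<in> S) + (\<Sum>l<t. leg_size S i k l)))"
    by (simp add: sum.cartesian_product[symmetric] sum.distrib leg_size_def
        del: sum_of_bool_eq)
  finally show ?thesis .
qed

lemma card_vertices: "card (vertices m t) = m * (9 * t + 4)"
proof -
  have "card (vertices m t) = (\<Sum>i<m. 1 + (\<Sum>k<3::nat. 1 + (\<Sum>l<t. 3)))"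
    unfolding card_eq_sum_of_gadgets[OF subset_refl]
    by (intro sum.cong refl arg_cong2[where f = "(+)"])
       (simp_all add: vertices_def leg_size_def)
  then show ?thesis by (simp add: algebra_simps)
qed

lemma gadget_tree_arcs:
  "(x, y) \<in> parcs (gadget_tree m t) \<longleftrightarrow> in_range m t x \<and> in_range m t y \<and>
     (x \<noteq> Centre 0 \<and> y = parent_of x \<or> y \<noteq> Centre 0 \<and> x = parent_of y)"
  by (simp add: gadget_tree_def parcs_parent_graph vertices_def)

text \<open>
  The three conditions come from the tip, the near vertex and the hub, in this order; they are what
  the bounds on sizes and the encoding below are based on.
\<close>

lemma dominating_gadget_treeD:
  assumes dom: "dominating_set (gadget_tree m t) S" and ik: "i < m" "k < 3"
  shows "l < t \<Longrightarrow> Mid i k l \<in> S \<or> Tip i k l \<in> S"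
    and "l < t \<Longrightarrow> Near i k l \<in> S \<or> Mid i k l \<in> S \<or> Hub i k \<in> S"
    and "Hub i k \<in> S \<or> Centre i \<in> S \<or> (\<exists>l<t. Near i k l \<in> S)"
proof -
  have nb: "v \<in> S \<or> (\<exists>u\<in>S. (v, u) \<in> parcs (gadget_tree m t))" if "in_range m t v" for v
    using dom that by (auto simp: dominating_set_def vertices_def)
  show "Mid i k l \<in> S \<or> Tip i k l \<in> S" if "l < t"
  proof -
    have "u = Mid i k l" if "(Tip i k l, u) \<in> parcs (gadget_tree m t)" for u
      using that unfolding gadget_tree_arcs by (cases u) auto
    then show ?thesis using nb[of "Tip i k l"] ik that by auto
  qed
  show "Near i k l \<in> S \<or> Mid i k l \<in> S \<or> Hub i k \<in> S" if "l < t"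
  proof -
    have "u = Mid i k l \<or> u = Hub i k" if "(Near i k l, u) \<in> parcs (gadget_tree m t)" for u
      using that unfolding gadget_tree_arcs by (cases u) auto
    then show ?thesis using nb[of "Near i k l"] ik that by auto
  qed
  have "u = Centre i \<or> (\<exists>l<t. u = Near i k l)"
    if "(Hub i k, u) \<in> parcs (gadget_tree m t)" for u
    using that unfolding gadget_tree_arcs by (cases u) auto
  then show "Hub i k \<in> S \<or> Centre i \<in> S \<or> (\<exists>l<t. Near i k l \<in> S)"
    using nb[of "Hub i k"] ik by auto
qed

section \<open>The number of hubs in a dominating set of given size\<close>

lemma sum_ge_extra:
  fixes f :: "nat \<Rightarrow> nat"
  assumes "\<And>l. l < t \<Longrightarrow> 1 \<le> f l" and "l < t" "2 \<le> f l"
  shows "t + 1 \<le> (\<Sum>l<t. f l)"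
proof -
  have "(\<Sum>l<t. f l) = f l + (\<Sum>l\<in>{..<t} - {l}. f l)"
    using assms(2) by (simp add: sum.remove)
  moreover have "(\<Sum>l\<in>{..<t} - {l}. 1) \<le> (\<Sum>l\<in>{..<t} - {l}. f l)"
    by (rule sum_mono) (use assms(1) in auto)
  ultimately show ?thesis using assms(2,3) by simp
qed

text \<open>
  Measured in thirds of a vertex, each hub together with its legs has size at least \<open>3t\<close>, plus
  \<open>2\<close> if the hub is chosen. If the centre is not chosen, there is one more third: a chosen hub
  counts three thirds, and a hub that is not chosen needs a second vertex in one of
  its legs. Three such thirds make up for the missing centre, so that in either case the gadget has
  a full extra vertex.
\<close>

lemma dominating_set_size_ge:
  assumes dom: "dominating_set (gadget_tree m t) S"
  shows "3 * (m * (3 * t + 1)) + 2 * hub_count m S \<le> 3 * card S"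
proof -
  note D = dominating_gadget_treeD[OF dom]
  define h where "h i k = (of_bool (Hub i k \<in> S) :: nat)" for i k
  define c where "c i k = (\<Sum>l<t. leg_size S i k l)" for i k
  have leg: "1 \<le> leg_size S i k l" if "i < m" "k < 3" "l < t" for i k l
    using D(1)[OF that] by (auto simp: leg_size_def)
  have c: "t \<le> c i k" if "i < m" "k < 3" for i k
  proof -
    have "(\<Sum>l<t. 1) \<le> c i k"
      unfolding c_def by (rule sum_mono) (use leg that in auto)
    then show ?thesis by simp
  qed
  have c': "t + 1 \<le> c i k" if ik: "i < m" "k < 3" and out: "Hub i k \<notin> S" "Centre i \<notin> S" for i k
  proof -
    obtain l where l: "l < t" "Near i k l \<in> S"
      using D(3)[OF ik] out by blast
    then have "2 \<le> leg_size S i k l"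
      using D(1)[OF ik l(1)] by (auto simp: leg_size_def)
    then show ?thesis
      unfolding c_def using sum_ge_extra leg[OF ik] l(1) by blast
  qed
  have gadget: "3 * (3 * t + 1) + 2 * (\<Sum>k<3. h i k)
      \<le> 3 * (of_bool (Centre i \<in> S) + (\<Sum>k<3. h i k + c i k))" if i: "i < m" for i
  proof (cases "Centre i \<in> S")
    case True
    have "(\<Sum>k<3. 3 * t + 2 * h i k) \<le> (\<Sum>k<3::nat. 3 * (h i k + c i k))"
    proof (rule sum_mono)
      show "3 * t + 2 * h i k \<le> 3 * (h i k + c i k)" if "k \<in> {..<3}" for k
        using c[OF i, of k] that by simp
    qed
    then show ?thesis using True by (simp add: sum.distrib sum_distrib_left)
  next
    case False
    have "(\<Sum>k<3. 3 * t + 1 + 2 * h i k) \<le> (\<Sum>k<3::nat. 3 * (h i k + c i k))"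
    proof (rule sum_mono)
      show "3 * t + 1 + 2 * h i k \<le> 3 * (h i k + c i k)" if "k \<in> {..<3}" for k
        using c[OF i, of k] c'[OF i, of k] that False by (cases "Hub i k \<in> S") (auto simp: h_def)
    qed
    then show ?thesis using False unfolding sum.distrib sum_distrib_left[symmetric] by simp
  qed
  have "3 * (m * (3 * t + 1)) + 2 * hub_count m S
      = (\<Sum>i<m. 3 * (3 * t + 1) + 2 * (\<Sum>k<3. h i k))"
    by (simp add: hub_count_def h_def sum.distrib sum_distrib_left algebra_simps)
  also have "\<dots> \<le> (\<Sum>i<m. 3 * (of_bool (Centre i \<in> S) + (\<Sum>k<3. h i k + c i k)))"
    using gadget by (intro sum_mono) simp
  also have "\<dots> = 3 * card S"
    using dom card_eq_sum_of_gadgets[of S m t]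
    by (simp add: dominating_set_def h_def c_def sum_distrib_left)
  finally show ?thesis .
qed

section \<open>Encoding dominating sets by their irregular part\<close>

text \<open>
  The part of a dominating set that does not follow the pattern of one vertex per leg: the
  centres and hubs, and the legs that contain at least two chosen vertices.
\<close>

definition core :: "vertex set \<Rightarrow> vertex set" where
  "core S = {x\<in>S. case x of Centre i \<Rightarrow> True | Hub i k \<Rightarrow> True
     | Near i k l \<Rightarrow> 2 \<le> leg_size S i k l
     | Mid i k l \<Rightarrow> 2 \<le> leg_size S i k l
     | Tip i k l \<Rightarrow> 2 \<le> leg_size S i k l}"

text \<open>
  Legs at a chosen hub leave the choice between mid and tip. Each of them is represented by its
  mid, so that the choices made in \<open>S\<close> are recorded by \<open>S \<inter> free_legs m t S\<close>.
\<close>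

definition free_legs :: "nat \<Rightarrow> nat \<Rightarrow> vertex set \<Rightarrow> vertex set" where
  "free_legs m t W = {Mid i k l | i k l. i < m \<and> k < 3 \<and> l < t \<and> Hub i k \<in> W}"

text \<open>
  The decoding that recovers a dominating set from its core \<open>W\<close> and its choices \<open>C\<close> in the free legs.
  With a \<open>W\<close> that contains no leg vertices it also builds dominating sets with many hubs.
\<close>

definition fill_legs :: "nat \<Rightarrow> nat \<Rightarrow> vertex set \<Rightarrow> vertex set \<Rightarrow> vertex set" where
  "fill_legs m t W C = W \<union> C \<union>
     {Mid i k l | i k l. i < m \<and> k < 3 \<and> l < t \<and> leg_size W i k l = 0 \<and> Hub i k \<notin> W} \<union>
     {Tip i k l | i k l. i < m \<and> k < 3 \<and> l < t \<and> leg_size W i k l = 0 \<and>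
        Hub i k \<in> W \<and> Mid i k l \<notin> C}"

lemma card_free_legs: "card (free_legs m t W) = t * hub_count m W"
proof -
  have "free_legs m t W \<subseteq> vertices m t"
    by (auto simp: free_legs_def vertices_def)
  then have "card (free_legs m t W) = (\<Sum>i<m. of_bool (Centre i \<in> free_legs m t W) +
    (\<Sum>k<3. of_bool (Hub i k \<in> free_legs m t W) + (\<Sum>l<t. leg_size (free_legs m t W) i k l)))"
    by (rule card_eq_sum_of_gadgets)
  also have "\<dots> = (\<Sum>i<m. \<Sum>k<3. \<Sum>l<t. of_bool (Hub i k \<in> W))"
    by (simp add: free_legs_def leg_size_def del: sum_of_bool_eq)
  also have "\<dots> = t * hub_count m W"
    by (simp add: hub_count_def sum_distrib_left del: sum_of_bool_eq)
  finally show ?thesis .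
qed

lemma leg_size_core: "leg_size (core S) i k l = (if 2 \<le> leg_size S i k l then leg_size S i k l else 0)"
  by (simp add: leg_size_def core_def)

lemma Hub_in_core: "Hub i k \<in> core S \<longleftrightarrow> Hub i k \<in> S"
  and Centre_in_core: "Centre i \<in> core S \<longleftrightarrow> Centre i \<in> S"
  by (simp_all add: core_def)

lemma core_subset: "core S \<subseteq> S"
  by (auto simp: core_def)

text \<open>
  A leg with \<open>s \<ge> 2\<close> chosen vertices contributes \<open>s \<le> 2 (s - 1)\<close> to the core, and one with
  \<open>s = 1\<close> contributes \<open>0 = 2 (s - 1)\<close>. So the size of the core is bounded by twice the number of
  vertices beyond one per leg, which does not depend on \<open>t\<close>.
\<close>

lemma card_core_le:
  assumes dom: "dominating_set (gadget_tree m t) S"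
  shows "card (core S) + 2 * (3 * m * t) \<le> 2 * card S"
proof -
  have sub: "S \<subseteq> vertices m t" using dom by (simp add: dominating_set_def)
  then have csub: "core S \<subseteq> vertices m t" using core_subset by blast
  have leg: "leg_size (core S) i k l + 2 \<le> 2 * leg_size S i k l"
    if "i < m" "k < 3" "l < t" for i k l
    using dominating_gadget_treeD(1)[OF dom that]
    by (auto simp: leg_size_core) (auto simp: leg_size_def)
  have "card (core S) + 2 * (3 * m * t) = (\<Sum>i<m. of_bool (Centre i \<in> S) +
      (\<Sum>k<3. of_bool (Hub i k \<in> S) + (\<Sum>l<t. leg_size (core S) i k l + 2)))"
    unfolding card_eq_sum_of_gadgets[OF csub] sum.distrib
    by (simp add: Hub_in_core Centre_in_core)
  also have "\<dots> \<le> (\<Sum>i<m. 2 * of_bool (Centre i \<in> S) +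
      (\<Sum>k<3. 2 * of_bool (Hub i k \<in> S) + (\<Sum>l<t. 2 * leg_size S i k l)))"
    by (intro sum_mono add_mono leg) auto
  also have "\<dots> = 2 * card S"
    unfolding card_eq_sum_of_gadgets[OF sub] by (simp add: sum_distrib_left distrib_left)
  finally show ?thesis .
qed

text \<open>
  A dominating set is determined by its core and by its choices in the free legs: the tip and the near
  vertex of any other leg force the mid.
\<close>

lemma fill_legs_core:
  assumes dom: "dominating_set (gadget_tree m t) S"
  shows "fill_legs m t (core S) (S \<inter> free_legs m t S) = S" (is "?L = S")
proof (rule set_eqI)
  fix x
  have sub: "S \<subseteq> vertices m t" using dom by (simp add: dominating_set_def)
  note D = dominating_gadget_treeD[OF dom]
  show "x \<in> ?L \<longleftrightarrow> x \<in> S"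
  proof (cases "in_range m t x")
    case False
    then have "x \<notin> S" using sub by (auto simp: vertices_def)
    moreover have "x \<notin> ?L"
      using False \<open>x \<notin> S\<close> core_subset by (cases x) (auto simp: fill_legs_def)
    ultimately show ?thesis by simp
  next
    case True
    show ?thesis
    proof (cases x)
      case (Near i k l)
      then show ?thesis using True D(1)[of i k l]
        by (auto simp: fill_legs_def core_def free_legs_def leg_size_def split: if_splits)
    next
      case (Mid i k l)
      then show ?thesis using True D(1)[of i k l] D(2)[of i k l]
        by (auto simp: fill_legs_def core_def free_legs_def leg_size_def split: if_splits)
    next
      case (Tip i k l)
      then show ?thesis using True D(1)[of i k l] D(2)[of i k l]
        by (auto simp: fill_legs_def core_def free_legs_def leg_size_def split: if_splits)
    qed (auto simp: fill_legs_def core_def free_legs_def)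
  qed
qed

section \<open>Counting dominating sets\<close>

lemma card_subsets_card_le:
  assumes "finite V"
  shows "finite {W. W \<subseteq> V \<and> card W \<le> K}" and "card {W. W \<subseteq> V \<and> card W \<le> K} \<le> (card V + 1) ^ K"
proof -
  show fin: "finite {W. W \<subseteq> V \<and> card W \<le> K}" for K
    by (rule finite_subset[of _ "Pow V"]) (use assms in auto)
  show "card {W. W \<subseteq> V \<and> card W \<le> K} \<le> (card V + 1) ^ K"
  proof (induction K)
    case 0
    have "{W. W \<subseteq> V \<and> card W \<le> 0} = {{}}"
      using assms finite_subset by fastforce
    then show ?case by simp
  next
    case (Suc K)
    let ?A = "{W. W \<subseteq> V \<and> card W \<le> K}"
    have "{W. W \<subseteq> V \<and> card W \<le> Suc K} \<subseteq> ?A \<union> (\<lambda>(x, W). insert x W) ` (V \<times> ?A)"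
    proof
      fix W assume W: "W \<in> {W. W \<subseteq> V \<and> card W \<le> Suc K}"
      show "W \<in> ?A \<union> (\<lambda>(x, W). insert x W) ` (V \<times> ?A)"
      proof (cases "W = {}")
        case False
        then obtain x where x: "x \<in> W" by blast
        then have "W = insert x (W - {x})" "x \<in> V" "W - {x} \<subseteq> V" "card (W - {x}) \<le> K"
          using W finite_subset[OF _ assms] by auto
        then show ?thesis by (force simp: image_iff)
      qed simp
    qed
    then have "card {W. W \<subseteq> V \<and> card W \<le> Suc K}
        \<le> card (?A \<union> (\<lambda>(x, W). insert x W) ` (V \<times> ?A))"
      by (rule card_mono[rotated]) (use fin assms in auto)
    also have "\<dots> \<le> card ?A + card (V \<times> ?A)"
      by (rule order.trans[OF card_Un_le add_left_mono[OF card_image_le]])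
         (use fin assms in auto)
    also have "\<dots> = (card V + 1) * card ?A" by (simp add: card_cartesian_product)
    also have "\<dots> \<le> (card V + 1) ^ Suc K" using mult_le_mono2[OF Suc.IH, of "card V + 1"] by simp
    finally show ?case .
  qed
qed

text \<open>
  There are polynomially many cores, as their size is bounded by \<open>K\<close>, and each hub in a core leaves
  at most \<open>2^t\<close> choices in its legs.
\<close>

lemma num_dominating_sets_le:
  assumes hubs: "\<And>S. dominating_set (gadget_tree m t) S \<Longrightarrow> card S = n \<Longrightarrow> hub_count m S \<le> h"
    and K: "2 * n \<le> K + 2 * (3 * m * t)"
  shows "num_dominating_sets (gadget_tree m t) n \<le> (card (vertices m t) + 1) ^ K * 2 ^ (t * h)"
proof -
  let ?D = "{S. dominating_set (gadget_tree m t) S \<and> card S = n}"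
  let ?W = "{W. W \<subseteq> vertices m t \<and> card W \<le> K}"
  let ?W' = "{W\<in>?W. hub_count m W \<le> h}"
  let ?P = "SIGMA W:?W'. Pow (free_legs m t W)"
  have hub_core: "hub_count m (core S) = hub_count m S" for S
    by (simp add: hub_count_def Hub_in_core)
  have free_core: "free_legs m t (core S) = free_legs m t S" for S
    by (simp add: free_legs_def Hub_in_core)
  have finW: "finite ?W'"
    by (rule finite_subset[OF _ card_subsets_card_le(1)[OF finite_vertices]]) auto
  have "free_legs m t W \<subseteq> vertices m t" for W
    by (auto simp: free_legs_def vertices_def)
  then have finF: "finite (free_legs m t W)" for W
    using finite_vertices finite_subset by blast
  have "?D \<subseteq> (\<lambda>(W, C). fill_legs m t W C) ` ?P"
  proof
    fix S assume S: "S \<in> ?D"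
    then have dom: "dominating_set (gadget_tree m t) S" by simp
    have "card (core S) \<le> K" using card_core_le[OF dom] K S by simp
    moreover have "core S \<subseteq> vertices m t"
      using dom core_subset by (fastforce simp: dominating_set_def)
    ultimately have "(core S, S \<inter> free_legs m t S) \<in> ?P"
      using hubs S by (auto simp: hub_core free_core)
    moreover have "S = (\<lambda>(W, C). fill_legs m t W C) (core S, S \<inter> free_legs m t S)"
      using fill_legs_core[OF dom] by simp
    ultimately show "S \<in> (\<lambda>(W, C). fill_legs m t W C) ` ?P"
      by (rule rev_image_eqI)
  qed
  then have "card ?D \<le> card ((\<lambda>(W, C). fill_legs m t W C) ` ?P)"
    by (rule card_mono[rotated]) (use finW finF in auto)
  also have "\<dots> \<le> card ?P"
    by (rule card_image_le) (use finW finF in auto)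
  also have "\<dots> = (\<Sum>W\<in>?W'. 2 ^ (t * hub_count m W))"
    using finW finF by (subst card_SigmaI) (auto simp: card_Pow card_free_legs)
  also have "\<dots> \<le> (\<Sum>W\<in>?W'. 2 ^ (t * h))"
    by (intro sum_mono power_increasing) auto
  also have "\<dots> = card ?W' * 2 ^ (t * h)" by simp
  also have "\<dots> \<le> (card (vertices m t) + 1) ^ K * 2 ^ (t * h)"
  proof (rule mult_le_mono1)
    have "card ?W' \<le> card ?W"
      by (rule card_mono) (use card_subsets_card_le(1)[OF finite_vertices] in auto)
    then show "card ?W' \<le> (card (vertices m t) + 1) ^ K"
      using card_subsets_card_le(2)[OF finite_vertices] le_trans by blast
  qed
  finally show ?thesis by (simp add: num_dominating_sets_def)
qed

text \<open>
  The centres and hubs of dominating sets that exceed the minimum by \<open>2 j\<close> vertices and contain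
  as many hubs as this allows: two extra vertices buy all three hubs of a gadget.
\<close>

definition skeleton :: "nat \<Rightarrow> nat \<Rightarrow> vertex set" where
  "skeleton m j = {Hub i k | i k. i < j \<and> k < 3} \<union> {Centre i | i. j \<le> i \<and> i < m}"

lemma hub_count_skeleton:
  assumes "j \<le> m"
  shows "hub_count m (skeleton m j) = 3 * j"
proof -
  have "hub_count m (skeleton m j) = (\<Sum>i<m. if i < j then 3 else 0)"
    unfolding hub_count_def by (rule sum.cong) (auto simp: skeleton_def)
  also have "\<dots> = (\<Sum>i<j. 3)"
    using assms by (intro sum.mono_neutral_cong_right) auto
  finally show ?thesis by simp
qed

lemma fill_legs_skeleton:
  assumes j: "j \<le> m" and C: "C \<subseteq> free_legs m t (skeleton m j)"
  shows "dominating_set (gadget_tree m t) (fill_legs m t (skeleton m j) C)" (is "dominating_set _ ?S")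
    and "card (fill_legs m t (skeleton m j) C) = m * (3 * t + 1) + 2 * j"
proof -
  have no_leg: "leg_size (skeleton m j) i k l = 0" for i k l
    by (simp add: leg_size_def skeleton_def)
  have CM: "c \<in> C \<Longrightarrow> \<exists>i k l. c = Mid i k l \<and> i < j \<and> k < 3 \<and> l < t" for c
    using C by (auto simp: free_legs_def skeleton_def)
  have mem_Centre: "Centre i \<in> ?S \<longleftrightarrow> j \<le> i \<and> i < m"
    and mem_Hub: "Hub i k \<in> ?S \<longleftrightarrow> i < j \<and> k < 3"
    and mem_Near: "Near i k l \<notin> ?S"
    and mem_Mid: "Mid i k l \<in> ?S \<longleftrightarrow> i < m \<and> k < 3 \<and> l < t \<and> (i < j \<longrightarrow> Mid i k l \<in> C)"
    and mem_Tip: "Tip i k l \<in> ?S \<longleftrightarrow> i < j \<and> k < 3 \<and> l < t \<and> Mid i k l \<notin> C" for i k l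
    using CM j by (auto simp: fill_legs_def skeleton_def no_leg[unfolded skeleton_def] dest: CM)
  have sub: "?S \<subseteq> vertices m t"
  proof
    fix x assume "x \<in> ?S" then show "x \<in> vertices m t"
      using j by (cases x) (auto simp: vertices_def mem_Centre mem_Hub mem_Near mem_Mid mem_Tip)
  qed
  show "dominating_set (gadget_tree m t) ?S"
    unfolding dominating_set_def pverts_gadget_tree
  proof (intro conjI ballI sub)
    fix v assume "v \<in> vertices m t"
    then have v: "in_range m t v" by (simp add: vertices_def)
    have nb: "\<exists>u\<in>?S. (v, u) \<in> parcs (gadget_tree m t)"
      if "u \<in> ?S" "v \<noteq> Centre 0 \<and> u = parent_of v \<or> u \<noteq> Centre 0 \<and> v = parent_of u" for u
      using that v sub by (auto simp: gadget_tree_arcs vertices_def)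
    show "v \<in> ?S \<or> (\<exists>u\<in>?S. (v, u) \<in> parcs (gadget_tree m t))"
    proof (cases v)
      case (Centre i)
      then show ?thesis using v nb[of "Hub i 0"]
        by (cases "i < j") (auto simp: mem_Centre mem_Hub)
    next
      case (Hub i k)
      then show ?thesis using v nb[of "Centre i"]
        by (cases "i < j") (auto simp: mem_Centre mem_Hub)
    next
      case (Near i k l)
      then show ?thesis using v nb[of "Hub i k"] nb[of "Mid i k l"]
        by (auto simp: mem_Hub mem_Mid)
    next
      case (Mid i k l)
      then show ?thesis using v nb[of "Tip i k l"] by (auto simp: mem_Mid mem_Tip)
    next
      case (Tip i k l)
      then show ?thesis using v nb[of "Mid i k l"] by (auto simp: mem_Mid mem_Tip)
    qed
  qed
  have leg: "leg_size ?S i k l = 1" if "i < m" "k < 3" "l < t" for i k l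
    using that j by (auto simp: leg_size_def mem_Near mem_Mid mem_Tip)
  have "card ?S = (\<Sum>i<m. (3 * t + 1) + (if i < j then 2 else 0))"
    unfolding card_eq_sum_of_gadgets[OF sub]
    by (intro sum.cong refl) (simp add: leg mem_Centre mem_Hub)
  also have "\<dots> = m * (3 * t + 1) + (\<Sum>i<m. if i < j then 2 else 0)"
    by (simp only: sum.distrib) simp
  also have "(\<Sum>i<m. if i < j then 2 else 0 :: nat) = (\<Sum>i<j. 2)"
    using j by (intro sum.mono_neutral_cong_right) auto
  finally show "card ?S = m * (3 * t + 1) + 2 * j" by simp
qed


lemma domination_number_gadget_tree:
  "domination_number (gadget_tree m t) = m * (3 * t + 1)"
  unfolding domination_number_def
proof (rule Min_eqI)
  have "{S. dominating_set (gadget_tree m t) S} \<subseteq> Pow (vertices m t)"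
    by (auto simp: dominating_set_def)
  then show "finite (card ` {S. dominating_set (gadget_tree m t) S})"
    using finite_vertices by (meson finite_Pow_iff finite_imageI finite_subset)
  show "m * (3 * t + 1) \<le> n" if "n \<in> card ` {S. dominating_set (gadget_tree m t) S}" for n
    using that dominating_set_size_ge by fastforce
  show "m * (3 * t + 1) \<in> card ` {S. dominating_set (gadget_tree m t) S}"
    using fill_legs_skeleton[of 0 m "{}" t] by (force simp: image_iff)
qed

lemma num_dominating_sets_ge:
  assumes "j \<le> m"
  shows "2 ^ (t * (3 * j)) \<le> num_dominating_sets (gadget_tree m t) (m * (3 * t + 1) + 2 * j)"
proof -
  let ?W = "skeleton m j"
  let ?D = "{S. dominating_set (gadget_tree m t) S \<and> card S = m * (3 * t + 1) + 2 * j}"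
  have fin: "finite ?D"
    by (rule finite_subset[of _ "Pow (vertices m t)"])
       (use finite_vertices in \<open>auto simp: dominating_set_def\<close>)
  have free: "free_legs m t ?W \<subseteq> vertices m t"
    by (auto simp: free_legs_def vertices_def)
  have recover: "fill_legs m t ?W C \<inter> free_legs m t ?W = C" if "C \<subseteq> free_legs m t ?W" for C
    using that by (auto simp: fill_legs_def free_legs_def skeleton_def)
  have "card (Pow (free_legs m t ?W)) \<le> card ?D"
  proof (rule card_inj_on_le[OF _ _ fin])
    show "inj_on (fill_legs m t ?W) (Pow (free_legs m t ?W))"
      by (rule inj_onI) (metis PowD recover)
    show "fill_legs m t ?W ` Pow (free_legs m t ?W) \<subseteq> ?D"
      using fill_legs_skeleton[OF assms] by blast
  qed
  moreover have "card (Pow (free_legs m t ?W)) = 2 ^ (t * (3 * j))"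
    using finite_subset[OF free finite_vertices]
    by (simp add: card_Pow card_free_legs hub_count_skeleton[OF assms])
  ultimately show ?thesis by (simp add: num_dominating_sets_def)
qed

text \<open>
  The rounding step: \<open>2 h \<le> 3 (2 j + 1)\<close> gives \<open>h \<le> 3 j + 1\<close>, half a hub
  less than the bound interpolated from the even excesses \<open>2 j\<close> and \<open>2 j + 2\<close>.
\<close>

lemma num_dominating_sets_odd_le:
  assumes "j < m"
  shows "num_dominating_sets (gadget_tree m t) (m * (3 * t + 1) + 2 * j + 1)
    \<le> (card (vertices m t) + 1) ^ (6 * m) * 2 ^ (t * (3 * j + 1))"
proof (rule num_dominating_sets_le)
  fix S assume "dominating_set (gadget_tree m t) S" "card S = m * (3 * t + 1) + 2 * j + 1"
  then have "2 * hub_count m S \<le> 3 * (2 * j + 1)"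
    using dominating_set_size_ge[of m t S] by simp
  then show "hub_count m S \<le> 3 * j + 1" by simp
next
  show "2 * (m * (3 * t + 1) + 2 * j + 1) \<le> 6 * m + 2 * (3 * m * t)"
    using assms by (simp add: algebra_simps)
qed

lemma ex_polynomial_less_two_power:
  fixes a b k :: nat
  shows "\<exists>t. (a * t + b) ^ k < 2 ^ t"
proof -
  \<comment> \<open>for \<open>t = 2^s\<close> the left side is at most \<open>2^((s + c) k)\<close>, so a linear function of \<open>s\<close> has to
    be less than \<open>2^s\<close>; \<open>s\<close> is taken even to bound \<open>2^s\<close> from below by a square\<close>
  define c where "c = a + b"
  define n where "n = 2 * k + c"
  define t :: nat where "t = 2 ^ (2 * n)"
  have "a * t + b \<le> c * t"
    by (simp add: c_def t_def distrib_right)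
  also have "\<dots> \<le> 2 ^ c * 2 ^ (2 * n)"
    unfolding t_def using less_exp[of c] by (intro mult_le_mono1) simp
  finally have "(a * t + b) ^ k \<le> (2 ^ (c + 2 * n)) ^ k"
    by (intro power_mono) (simp_all add: power_add)
  also have "\<dots> = 2 ^ ((c + 2 * n) * k)" by (simp only: power_mult)
  also have "\<dots> < 2 ^ t"
  proof (rule power_strict_increasing)
    have "(c + 2 * n) * k \<le> n * n"
      by (simp add: n_def algebra_simps)
    also have "\<dots> < 2 ^ n * 2 ^ n"
      using less_exp[of n] by (intro mult_strict_mono) auto
    also have "\<dots> = t" by (simp add: t_def power_add[symmetric])
    finally show "(c + 2 * n) * k < t" .
  qed simp
  finally show ?thesis by blast
qed

lemma gadget_tree_nat_copy:
  assumes "1 \<le> m"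
  shows "\<exists>T :: nat pair_pre_digraph. undirected_tree T \<and>
    domination_number T = domination_number (gadget_tree m t) \<and>
    (\<forall>n. num_dominating_sets T n = num_dominating_sets (gadget_tree m t) n)"
  unfolding gadget_tree_def
proof (rule parent_graph_nat_copy[where rank = depth])
  show "parent_of x \<in> vertices m t \<and> depth (parent_of x) < depth x"
    if "x \<in> vertices m t" "x \<noteq> Centre 0" for x
    using that by (cases x) (auto simp: vertices_def)
qed (use assms finite_vertices in \<open>auto simp: vertices_def\<close>)

theorem theorem1p2:
  fixes m :: nat
  assumes "m \<ge> 1"
  shows "\<exists>T :: nat pair_pre_digraph. undirected_tree T \<and>
    (let \<gamma> = domination_number T in
      \<forall>j::nat. j \<le> m - 1 \<longrightarrow>
        (num_dominating_sets T (\<gamma> + 2 * j + 1))\<^sup>2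
          < num_dominating_sets T (\<gamma> + 2 * j) * num_dominating_sets T (\<gamma> + 2 * j + 2))"
proof -
  obtain t where t: "(9 * m * t + (4 * m + 1)) ^ (12 * m) < 2 ^ t"
    using ex_polynomial_less_two_power by blast
  let ?G = "gadget_tree m t" and ?\<gamma> = "m * (3 * t + 1)" and ?v = "card (vertices m t) + 1"
  have v: "?v ^ (12 * m) < 2 ^ t"
    using t by (simp add: card_vertices algebra_simps)
  have G: "(num_dominating_sets ?G (?\<gamma> + 2 * j + 1))\<^sup>2
      < num_dominating_sets ?G (?\<gamma> + 2 * j) * num_dominating_sets ?G (?\<gamma> + 2 * j + 2)"
    if "j \<le> m - 1" for j
  proof -
    have j: "j < m" using that assms by simp
    have "(num_dominating_sets ?G (?\<gamma> + 2 * j + 1))\<^sup>2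
        \<le> (?v ^ (6 * m) * 2 ^ (t * (3 * j + 1)))\<^sup>2"
      by (rule power_mono[OF num_dominating_sets_odd_le[OF j]]) simp
    also have "\<dots> = ?v ^ (12 * m) * 2 ^ (2 * (t * (3 * j + 1)))"
      by (simp only: power_mult_distrib power_mult[symmetric]) (simp add: mult.commute)
    also have "\<dots> < 2 ^ t * 2 ^ (2 * (t * (3 * j + 1)))"
      using v by simp
    also have "\<dots> = 2 ^ (t * (3 * j)) * 2 ^ (t * (3 * (j + 1)))"
      by (simp add: power_add[symmetric] algebra_simps)
    also have "\<dots> \<le> num_dominating_sets ?G (?\<gamma> + 2 * j) * num_dominating_sets ?G (?\<gamma> + 2 * (j + 1))"
      by (intro mult_le_mono num_dominating_sets_ge) (use j in simp_all)
    finally show ?thesis by (simp add: add.assoc)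
  qed
  obtain T :: "nat pair_pre_digraph" where "undirected_tree T"
    and "domination_number T = ?\<gamma>"
    and "\<And>n. num_dominating_sets T n = num_dominating_sets ?G n"
    using gadget_tree_nat_copy[OF assms, of t] by (auto simp: domination_number_gadget_tree)
  then show ?thesis using G by (intro exI[of _ T]) (simp add: Let_def)
qed

end
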